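(* Let $k\ge 1$ be an integer. A cubefree complementary morphism of length $k$ exists if and only if $k\ne 3$ and $k\neq 6$.
   Context: Words are finite or (one-sided) infinite, over the alphabet $\{0,1\}$. The complement $\overline{w}$ of a binary word $w$ is obtained by exchanging $0$ and $1$ letterwise. A factor is a contiguous sub-block. For a finite nonempty word $w$ of length $n$, an integer $p$ with $1\le p\le n$ is a period of $w$ if $w[i]=w[i+p]$ for $0\le i<n-p$; $\mathrm{per}(w)$ is the smallest period, and $\exp(w)=n/\mathrm{per}(w)$. The critical exponent $\mathrm{cexp}(w)$ of a finite or infinite word $w$ is the supremum of $\exp(x)$ over all finite nonempty factors $x$ of $w$. A word $w$ is cubefree (i.e. $3$-free) if $\mathrm{cexp}(w)<3$. A morphism $h$ (a map with $h(xy)=h(x)h(y)$) is cubefree if for all words $w$: $w$ cubefree implies $h(w)$ cubefree. A morphism is $k$-uniform, or of length $k$, if it maps every letter to a word of length $k$. A uniform binary morphism $h:\{0,1\}^*\to\{0,1\}^*$ is complementary if $h(1)=\overline{h(0)}$. *)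

theory Defs
  imports Complex_Main "HOL-Library.Extended_Real" "HOL-Library.Sublist"
begin

text \<open>The binary alphabet is \<^typ>\<open>bool\<close>: the letter 0 is \<^const>\<open>False\<close>, the letter 1 is \<^const>\<open>True\<close>.\<close>

datatype 'a fiword = Fin "'a list" | Inf "nat \<Rightarrow> 'a"

fun factors :: "'a fiword \<Rightarrow> 'a list set" where
  "factors (Fin w) = {x. sublist x w}"
| "factors (Inf w) = {x. \<exists>i j. x = map w [i..<j]}"

definition is_period :: "nat \<Rightarrow> 'a list \<Rightarrow> bool" where
  "is_period p w \<longleftrightarrow> 1 \<le> p \<and> p \<le> length w \<and> (\<forall>i. i < length w - p \<longrightarrow> w ! i = w ! (i + p))"

text \<open>A nonempty word always has its length as a period; on the empty word the values of
  \<open>per\<close> and \<open>word_exp\<close> are junk and are never used.\<close>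

definition per :: "'a list \<Rightarrow> nat" where
  "per w = (LEAST p. is_period p w)"

definition word_exp :: "'a list \<Rightarrow> real" where
  "word_exp w = real (length w) / real (per w)"

text \<open>The supremum is taken in the extended reals: it is \<open>\<infinity>\<close> if the exponents
  are unbounded, and \<open>-\<infinity>\<close> for the empty word, which is therefore cubefree.\<close>

definition cexp :: "'a fiword \<Rightarrow> ereal" where
  "cexp w = (SUP x \<in> {x \<in> factors w. x \<noteq> []}. ereal (word_exp x))"

definition cubefree :: "'a fiword \<Rightarrow> bool" where
  "cubefree w \<longleftrightarrow> cexp w < 3"

definition is_morphism :: "('a list \<Rightarrow> 'b list) \<Rightarrow> bool" where
  "is_morphism h \<longleftrightarrow> (\<forall>x y. h (x @ y) = h x @ h y)"

text \<open>The image of an infinite word under a morphism is the limit of the images of its finite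
  prefixes. If the lengths of these images are bounded (an erasing morphism), the limit is
  a finite word, namely the common value of all sufficiently late images.\<close>

fun image_word :: "('a list \<Rightarrow> 'b list) \<Rightarrow> 'a fiword \<Rightarrow> 'b fiword" where
  "image_word h (Fin w) = Fin (h w)"
| "image_word h (Inf w) =
    (if \<forall>i. \<exists>n. i < length (h (map w [0..<n]))
     then Inf (\<lambda>i. h (map w [0..<(LEAST n. i < length (h (map w [0..<n])))]) ! i)
     else Fin (h (map w [0..<(LEAST n. \<forall>m\<ge>n. h (map w [0..<m]) = h (map w [0..<n]))])))"

definition cubefree_morphism :: "('a list \<Rightarrow> 'b list) \<Rightarrow> bool" where
  "cubefree_morphism h \<longleftrightarrow> is_morphism h \<and> (\<forall>w. cubefree w \<longrightarrow> cubefree (image_word h w))"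

definition uniform :: "nat \<Rightarrow> ('a list \<Rightarrow> 'b list) \<Rightarrow> bool" where
  "uniform k h \<longleftrightarrow> is_morphism h \<and> (\<forall>a. length (h [a]) = k)"

definition complement :: "bool list \<Rightarrow> bool list" where
  "complement w = map Not w"

definition complementary :: "(bool list \<Rightarrow> bool list) \<Rightarrow> bool" where
  "complementary h \<longleftrightarrow> (\<exists>k. uniform k h) \<and> h [True] = complement (h [False])"

end

theory Submission
  imports Defs
begin

text \<open>
  Such a morphism is given by a word \<open>u\<close>, the image of 0. The images \<open>u\<close> and its complement differ in
  every position, so a run in an image whose period is a multiple of the block length \<open>k\<close> comes
  from a run of the same or larger exponent in the preimage (\<open>run_block_seq_desubstitute\<close>). It remains to
  control the other periods. If the block boundaries can be recognised in every long factor of an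
  image, these periods give exponents below 2 except for finitely many short ones, for which cubes must be
  excluded (\<open>runs_bounded_block_seq\<close>). The resulting exponents stay away from 3 uniformly, as the
  treatment of infinite words requires.

  Boundaries are recognised by a marker: \<open>u = t @ m\<close>, where \<open>m\<close> and its complement occur in images
  only at the ends of blocks. A cube of period at least \<open>length m\<close> that contains a marker has
  a period divisible by \<open>k\<close>, so only very short cubes and cubes between two consecutive markers have
  to be excluded (\<open>cubefree_block_marker\<close>). Taking for \<open>t\<close> a factor of the Thue-Morse sequence,
  which is overlap-free, rules out the cubes between markers when \<open>t\<close> is long, and the short cubes are
  visible in finitely many windows around the marker (\<open>cubefree_block_thue_morse_marker\<close>). No single
  marker can follow every factor, since a first letter 0 creates a cube after 00 and a first letter 1 creates
  one after 11. With
  \<open>t\<close> ending at a multiple of 4, one marker of length 11 and one of length 12 produce all large lengths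
  congruent to 3 and 1 modulo 4. Smaller odd lengths and 12 are checked by computation, and the
  remaining even lengths arise by composition with the Thue-Morse morphism 0 \<open>\<mapsto>\<close> 01, 1 \<open>\<mapsto>\<close> 10.

  Conversely, for every word \<open>u\<close> of length 3 or 6 the image of the cubefree word 001 contains a cube.
\<close>

section \<open>Exponents and runs\<close>

text \<open>Periodicity of a factor is stated in terms of the surrounding sequence and the position \<open>s\<close> and length
  \<open>n\<close> of the factor. Finite and infinite words then share all the combinatorics: a finite word is a
  sequence with a range of valid positions.\<close>
definition run :: "(nat \<Rightarrow> 'a) \<Rightarrow> nat \<Rightarrow> nat \<Rightarrow> nat \<Rightarrow> bool" where
  "run x p s n \<longleftrightarrow> (\<forall>i. s \<le> i \<longrightarrow> i + p < s + n \<longrightarrow> x i = x (i + p))"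

text \<open>The bound is on every period, not only on the smallest period of a factor; a smaller period
  gives a larger exponent, so both bounds say the same.\<close>
definition runs_bounded :: "real \<Rightarrow> (nat \<Rightarrow> 'a) \<Rightarrow> nat \<Rightarrow> bool" where
  "runs_bounded e x N \<longleftrightarrow>
    (\<forall>p s n. 1 \<le> p \<longrightarrow> p \<le> n \<longrightarrow> s + n \<le> N \<longrightarrow> run x p s n \<longrightarrow> real n \<le> e * real p)"

lemma is_period_map_iff_run:
  "is_period p (map x [s..<s+n]) \<longleftrightarrow> 1 \<le> p \<and> p \<le> n \<and> run x p s n"
proof -
  have "(\<forall>i<n-p. x (s + i) = x (s + (i + p))) \<longleftrightarrow> run x p s n" if "p \<le> n"
  proof
    assume *: "\<forall>i<n-p. x (s + i) = x (s + (i + p))"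
    show "run x p s n" unfolding run_def
    proof (intro allI impI)
      fix i assume "s \<le> i" "i + p < s + n"
      then show "x i = x (i + p)" using *[rule_format, of "i - s"] by auto
    qed
  next
    assume "run x p s n"
    then show "\<forall>i<n-p. x (s + i) = x (s + (i + p))"
      unfolding run_def by (auto simp: add.assoc dest!: spec[of _ "s + _"])
  qed
  then show ?thesis unfolding is_period_def by auto
qed

text \<open>The supremum in the critical exponent is strictly below 3 exactly if one real number below 3
  bounds all exponents. For infinite words this is stronger than the absence of cubes, which is why
  the bound \<open>e\<close> is carried through everything that follows.\<close>
lemma cubefree_iff_run_length:
  assumes W: "factors W = {map x [s..<s+n] | s n. Q (s + n)}"
  shows "cubefree W \<longleftrightarrow>
    (\<exists>e<3. \<forall>p s n. 1 \<le> p \<longrightarrow> p \<le> n \<longrightarrow> Q (s + n) \<longrightarrow> run x p s n \<longrightarrow> real n \<le> e * real p)"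
proof
  assume "cubefree W"
  then obtain e where e: "cexp W < ereal e" "e < 3"
    unfolding cubefree_def using ereal_dense2[of "cexp W" 3] by auto
  have "real n \<le> e * real p" if "1 \<le> p" "p \<le> n" "Q (s + n)" "run x p s n" for p s n
  proof -
    let ?f = "map x [s..<s+n]"
    have p: "is_period p ?f" using that by (simp add: is_period_map_iff_run)
    have per: "is_period (per ?f) ?f" "per ?f \<le> p"
      unfolding per_def using p by (auto intro: LeastI Least_le)
    have "?f \<noteq> []" "?f \<in> factors W" using that unfolding W by auto
    then have "ereal (word_exp ?f) \<le> cexp W" unfolding cexp_def by (intro SUP_upper) auto
    then have "word_exp ?f < e" using e(1) by (metis le_less_trans less_ereal.simps(1))
    then have *: "real n / real (per ?f) < e" by (simp add: word_exp_def)
    have "per ?f \<ge> 1" using per(1) by (simp add: is_period_def)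
    then have "real n < e * real (per ?f)" using * by (simp add: field_simps)
    also have "\<dots> \<le> e * real p"
    proof (intro mult_left_mono)
      show "0 \<le> e" using * by (meson divide_nonneg_nonneg less_imp_le of_nat_0_le_iff order_trans)
    qed (use per(2) in auto)
    finally show ?thesis by simp
  qed
  then show "\<exists>e<3. \<forall>p s n. 1 \<le> p \<longrightarrow> p \<le> n \<longrightarrow> Q (s + n) \<longrightarrow> run x p s n \<longrightarrow> real n \<le> e * real p"
    using e(2) by blast
next
  assume "\<exists>e<3. \<forall>p s n. 1 \<le> p \<longrightarrow> p \<le> n \<longrightarrow> Q (s + n) \<longrightarrow> run x p s n \<longrightarrow> real n \<le> e * real p"
  then obtain e where e: "e < 3"
    "\<And>p s n. 1 \<le> p \<Longrightarrow> p \<le> n \<Longrightarrow> Q (s + n) \<Longrightarrow> run x p s n \<Longrightarrow> real n \<le> e * real p" by blast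
  have "cexp W \<le> ereal e" unfolding cexp_def
  proof (rule SUP_least)
    fix f assume "f \<in> {f \<in> factors W. f \<noteq> []}"
    then obtain s n where f: "f = map x [s..<s+n]" "Q (s + n)" "n \<ge> 1" unfolding W by force
    then have "is_period n f" by (auto simp: is_period_map_iff_run run_def)
    then have "is_period (per f) f" unfolding per_def by (rule LeastI)
    then have "1 \<le> per f" "per f \<le> n" "run x (per f) s n" unfolding f(1) by (auto simp: is_period_map_iff_run)
    then have "1 \<le> per f" "real n \<le> e * real (per f)" using e(2) f(2) by auto
    then show "ereal (word_exp f) \<le> ereal e" by (simp add: word_exp_def f(1) field_simps)
  qed
  also have "ereal e < 3" using e(1) by (metis less_ereal.simps(1) numeral_eq_ereal)
  finally show "cubefree W" unfolding cubefree_def .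
qed

lemma cubefree_Fin_iff: "cubefree (Fin w) \<longleftrightarrow> (\<exists>e<3. runs_bounded e (nth w) (length w))"
proof -
  have "factors (Fin w) = {map (nth w) [s..<s+n] | s n. s + n \<le> length w}"
  proof (intro set_eqI iffI)
    fix f assume "f \<in> factors (Fin w)"
    then obtain a b where "w = a @ f @ b" by (auto simp: sublist_def)
    then have "f = map (nth w) [length a..<length a + length f]" "length a + length f \<le> length w"
      by (auto intro!: nth_equalityI simp: nth_append)
    then show "f \<in> {map (nth w) [s..<s+n] | s n. s + n \<le> length w}" by blast
  next
    fix f assume "f \<in> {map (nth w) [s..<s+n] | s n. s + n \<le> length w}"
    then obtain s n where "f = map (nth w) [s..<s+n]" "s + n \<le> length w" by blast
    then have "f = take n (drop s w)" by (auto intro: nth_equalityI)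
    then show "f \<in> factors (Fin w)"
      by (metis factors.simps(1) mem_Collect_eq sublist_drop sublist_order.order_trans sublist_take)
  qed
  from cubefree_iff_run_length[OF this] show ?thesis unfolding runs_bounded_def .
qed

lemma cubefree_Inf_iff: "cubefree (Inf x) \<longleftrightarrow> (\<exists>e<3. \<forall>N. runs_bounded e x N)"
proof -
  have "factors (Inf x) = {map x [s..<s+n] | s n. True}"
  proof (intro set_eqI iffI)
    fix f assume "f \<in> factors (Inf x)"
    then obtain i j where "f = map x [i..<j]" by auto
    then have "f = map x [i..<i+(j-i)]" by (cases "i \<le> j") auto
    then show "f \<in> {map x [s..<s+n] | s n. True}" by blast
  qed auto
  from cubefree_iff_run_length[OF this] show ?thesis unfolding runs_bounded_def by blast
qed

lemma cubefree_no_cube: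
  assumes "cubefree (Fin w)" "1 \<le> p" "s + 3 * p \<le> length w"
  shows "\<not> run (nth w) p s (3 * p)"
proof
  assume run: "run (nth w) p s (3 * p)"
  obtain e where e: "e < 3" "runs_bounded e (nth w) (length w)"
    using assms(1) unfolding cubefree_Fin_iff by blast
  have "real (3 * p) \<le> e * real p"
    using e(2)[unfolded runs_bounded_def, rule_format, of p "3 * p" s] assms(2,3) run by simp
  moreover have "e * real p < 3 * real p" using e(1) assms(2) by simp
  ultimately show False by simp
qed

section \<open>Images under complementary morphisms\<close>

text \<open>The image of the sequence \<open>w\<close> under the morphism 0 \<open>\<mapsto>\<close> \<open>u\<close>, 1 \<open>\<mapsto>\<close> complement of \<open>u\<close>: the letter
  of \<open>w\<close> that generates a position decides whether the letter of \<open>u\<close> is flipped there.\<close>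
definition block_seq :: "bool list \<Rightarrow> (nat \<Rightarrow> bool) \<Rightarrow> nat \<Rightarrow> bool" where
  "block_seq u w i \<longleftrightarrow> u ! (i mod length u) \<noteq> w (i div length u)"

definition block_map :: "bool list \<Rightarrow> bool list \<Rightarrow> bool list" where
  "block_map u w = concat (map (\<lambda>a. map (\<lambda>x. x \<noteq> a) u) w)"

lemma length_block_map [simp]: "length (block_map u w) = length u * length w"
  by (induction w) (auto simp: block_map_def)

lemma nth_block_map:
  "i < length u * length w \<Longrightarrow> block_map u w ! i = block_seq u (nth w) i"
proof (induction w arbitrary: i)
  case (Cons a w)
  then have u: "length u > 0" by (cases u) auto
  have *: "block_map u (a # w) = map (\<lambda>x. x \<noteq> a) u @ block_map u w" by (simp add: block_map_def)
  show ?case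
  proof (cases "i < length u")
    case True
    then show ?thesis by (simp add: * nth_append block_seq_def)
  next
    case False
    then obtain j where j: "i = length u + j" using le_Suc_ex by (metis not_less)
    then have "block_map u w ! j = block_seq u (nth w) j" using Cons by simp
    then show ?thesis using j u by (simp add: * nth_append block_seq_def)
  qed
qed simp

lemma block_seq_cong:
  "(\<And>q. q < N \<Longrightarrow> w q = w' q) \<Longrightarrow> i < length u * N \<Longrightarrow> block_seq u w i = block_seq u w' i"
  by (simp add: block_seq_def less_mult_imp_div_less mult.commute)

lemma morphism_eq_block_map:
  assumes "uniform k h" "complementary h"
  shows "h w = block_map (h [False]) w"
proof (induction w)
  case Nil
  have "h ([] @ []) = h [] @ h []" using assms(1) unfolding uniform_def is_morphism_def by blast
  then show ?case by (simp add: block_map_def)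
next
  case (Cons a w)
  have "h ([a] @ w) = h [a] @ h w" using assms(1) unfolding uniform_def is_morphism_def by blast
  moreover have "h [a] = map (\<lambda>x. x \<noteq> a) (h [False])"
    using assms(2) by (cases a) (auto simp: complementary_def complement_def)
  ultimately show ?case using Cons by (simp add: block_map_def)
qed

text \<open>Position \<open>i\<close> of the image is settled by the first \<open>i div length u + 1\<close> letters, which makes the
  limit of the images of the prefixes explicit.\<close>
lemma image_word_block_map_Inf:
  assumes "u \<noteq> []"
  shows "image_word (block_map u) (Inf w) = Inf (block_seq u w)"
proof -
  let ?k = "length u"
  have k: "?k > 0" using assms by simp
  have "(LEAST n. i < ?k * n) = Suc (i div ?k)" for i
  proof (rule Least_equality)
    show "i < ?k * Suc (i div ?k)" using k by (metis dividend_less_times_div mult_Suc_right)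
    show "Suc (i div ?k) \<le> n" if "i < ?k * n" for n
      using that k by (metis Suc_leI less_mult_imp_div_less mult.commute)
  qed
  moreover have "\<exists>n. i < ?k * n" for i using k by (metis Suc_le_lessD Suc_leI k mult.left_neutral mult_le_mono1 One_nat_def)
  moreover have "block_map u (map w [0..<Suc (i div ?k)]) ! i = block_seq u w i" for i
  proof -
    have i: "i < ?k * Suc (i div ?k)" using k by (metis dividend_less_times_div mult_Suc_right)
    then have "block_map u (map w [0..<Suc (i div ?k)]) ! i
        = block_seq u (nth (map w [0..<Suc (i div ?k)])) i" by (intro nth_block_map) (simp del: upt_Suc)
    also have "\<dots> = block_seq u w i" using i by (intro block_seq_cong[of "Suc (i div ?k)"]) (auto simp del: upt_Suc simp: nth_map_upt)
    finally show ?thesis .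
  qed
  ultimately show ?thesis by simp
qed

text \<open>The bound \<open>e\<close> is inherited by the image as soon as it exceeds a threshold \<open>c < 3\<close> that depends
  on the block alone. The threshold covers the powers that the block creates by itself. Prefixes of
  all lengths \<open>N\<close> are treated with the same \<open>e\<close>, so the statement applies to infinite words too.\<close>
definition cubefree_block :: "bool list \<Rightarrow> bool" where
  "cubefree_block u \<longleftrightarrow> u \<noteq> [] \<and> (\<exists>c<3. \<forall>e w N. c \<le> e \<longrightarrow> e < 3 \<longrightarrow>
     runs_bounded e w N \<longrightarrow> runs_bounded e (block_seq u w) (length u * N))"

lemma runs_bounded_mono: "runs_bounded e x N \<Longrightarrow> e \<le> e' \<Longrightarrow> runs_bounded e' x N"
  unfolding runs_bounded_def by (meson mult_right_mono of_nat_0_le_iff order_trans)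

lemma runs_bounded_antimono: "runs_bounded e x N \<Longrightarrow> M \<le> N \<Longrightarrow> runs_bounded e x M"
  unfolding runs_bounded_def by (meson le_trans)

lemma runs_bounded_cong:
  assumes "\<And>i. i < N \<Longrightarrow> x i = y i" "runs_bounded e x N"
  shows "runs_bounded e y N"
  unfolding runs_bounded_def
proof (intro allI impI)
  fix p s n assume *: "1 \<le> p" "p \<le> n" "s + n \<le> N" "run y p s n"
  then have "run x p s n" using assms(1) unfolding run_def by auto
  then show "real n \<le> e * real p" using * assms(2) unfolding runs_bounded_def by blast
qed

lemma cubefree_block_imp_morphism:
  assumes "cubefree_block u"
  shows "\<exists>h. uniform (length u) h \<and> complementary h \<and> cubefree_morphism h"
proof (intro exI conjI)
  let ?h = "block_map u"
  obtain c where u: "u \<noteq> []" and c: "c < 3" "\<And>e w N. c \<le> e \<Longrightarrow> e < 3 \<Longrightarrow> runs_bounded e w N \<Longrightarrow>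
      runs_bounded e (block_seq u w) (length u * N)"
    using assms unfolding cubefree_block_def by blast
  have morph: "is_morphism ?h" by (simp add: is_morphism_def block_map_def)
  then show unif: "uniform (length u) ?h" by (simp add: uniform_def)
  show "complementary ?h" using unif
    by (auto simp: complementary_def block_map_def complement_def)
  have "cubefree (image_word ?h W)" if W: "cubefree W" for W
  proof (cases W)
    case (Fin w)
    then obtain e where e: "e < 3" "runs_bounded e (nth w) (length w)"
      using W unfolding Fin cubefree_Fin_iff by blast
    have "runs_bounded (max c e) (block_seq u (nth w)) (length u * length w)"
      using e c(1) runs_bounded_mono[OF e(2), of "max c e"] by (intro c(2)) auto
    then have "runs_bounded (max c e) (nth (?h w)) (length (?h w))"
      by (auto intro: runs_bounded_cong[rotated] simp: nth_block_map)
    then show ?thesis using Fin e(1) c(1)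
      by (auto simp: cubefree_Fin_iff intro!: exI[of _ "max c e"])
  next
    case (Inf w)
    then obtain e where e: "e < 3" "\<And>N. runs_bounded e w N" using W unfolding Inf cubefree_Inf_iff by blast
    have "runs_bounded (max c e) (block_seq u w) N" for N
    proof (rule runs_bounded_antimono)
      show "runs_bounded (max c e) (block_seq u w) (length u * N)"
        using e(1) c(1) runs_bounded_mono[OF e(2), of "max c e"] by (intro c(2)) auto
      show "N \<le> length u * N" using u by (cases u) auto
    qed
    then show ?thesis using Inf e(1) c(1) u
      by (auto simp: cubefree_Inf_iff image_word_block_map_Inf simp del: image_word.simps
        intro!: exI[of _ "max c e"])
  qed
  then show "cubefree_morphism ?h" using morph by (simp add: cubefree_morphism_def)
qed

section \<open>Runs in images\<close>

text \<open>The two images of letters differ in every position. Hence a single agreement at distance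
  \<open>length u * q\<close> in the image forces two letters of \<open>w\<close> at distance \<open>q\<close> to be equal, and a run whose
  period is a multiple of the block length extends to whole blocks at both ends.\<close>
lemma run_block_seq_desubstitute:
  assumes "u \<noteq> []" "run (block_seq u w) (length u * q) s n" "length u * q < n"
  shows "run w q (s div length u) ((s + n - 1) div length u + 1 - s div length u)"
  unfolding run_def
proof (intro allI impI)
  let ?k = "length u"
  fix i assume i: "s div ?k \<le> i" "i + q < s div ?k + ((s + n - 1) div ?k + 1 - s div ?k)"
  have k: "?k > 0" using assms(1) by simp
  define t where "t = max s (?k * i)"
  have "s div ?k \<le> (s + n - 1) div ?k" using assms(3) by (intro div_le_mono) simp
  then have iq: "i + q \<le> (s + n - 1) div ?k" using i(2) by simp
  have t: "t div ?k = i"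
  proof (cases "s \<le> ?k * i")
    case True then show ?thesis using k by (simp add: t_def max_def)
  next
    case False
    then have "i \<le> s div ?k" using k by (metis div_le_mono nat_le_linear nonzero_mult_div_cancel_left not_gr_zero)
    then show ?thesis using i(1) False by (simp add: t_def max_def)
  qed
  have "?k * i + ?k * q \<le> s + n - 1"
    using iq k by (metis distrib_left less_eq_div_iff_mult_less_eq mult.commute)
  then have "t + ?k * q < s + n" using assms(3) by (auto simp: t_def max_def)
  then have "block_seq u w t = block_seq u w (t + ?k * q)"
    using assms(2) unfolding run_def by (auto simp: t_def)
  moreover have "(t + ?k * q) div ?k = i + q" "(t + ?k * q) mod ?k = t mod ?k" using t k by auto
  ultimately show "w i = w (i + q)" using t by (auto simp: block_seq_def)
qed

text \<open>The mechanism behind all constructions. If equal factors of length \<open>L\<close> can only occur at positions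
  congruent modulo the block length, a run of period \<open>p\<close> not divisible by the block length is
  shorter than \<open>p + L\<close>. For \<open>p \<ge> L\<close> its exponent is below 2, and for \<open>p < L\<close> the absence of cubes of
  period \<open>p\<close> bounds it by \<open>3 - 1 / p\<close>. Only cubes with \<open>2 * p < L\<close> need to be excluded, since a cube
  contains two copies of a factor of length \<open>2 * p\<close>. Runs whose period is a multiple of the block length
  are images of runs.\<close>
lemma runs_bounded_block_seq:
  fixes u :: "bool list"
  defines "k \<equiv> length u"
  assumes u: "u \<noteq> []" and L: "L \<ge> 1" and e: "2 \<le> e" "3 - 1 / real L \<le> e"
    and w: "runs_bounded e w N"
    and sync: "\<And>i j. i + L \<le> k * N \<Longrightarrow> j + L \<le> k * N \<Longrightarrow>
        (\<forall>t<L. block_seq u w (i + t) = block_seq u w (j + t)) \<Longrightarrow> i mod k = j mod k"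
    and cubes: "\<And>p s. 1 \<le> p \<Longrightarrow> 2 * p < L \<Longrightarrow> \<not> k dvd p \<Longrightarrow> s + 3 * p \<le> k * N \<Longrightarrow>
        \<not> run (block_seq u w) p s (3 * p)"
  shows "runs_bounded e (block_seq u w) (k * N)"
  unfolding runs_bounded_def
proof (intro allI impI)
  fix p s n assume p: "1 \<le> p" "p \<le> n" and sn: "s + n \<le> k * N" and run: "run (block_seq u w) p s n"
  have k: "k > 0" using u by (simp add: k_def)
  consider "n = p" | "p < n" "k dvd p" | "p < n" "\<not> k dvd p" using p(2) by linarith
  then show "real n \<le> e * real p"
  proof cases
    case 1
    then show ?thesis using e(1) mult_right_mono[of 1 e "real p"] by simp
  next
    case 2
    then obtain q where q: "p = k * q" by blast
    let ?a = "s div k" and ?b = "(s + n - 1) div k"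
    have q1: "q \<ge> 1" using q p(1) by (cases q) auto
    have "?a + q \<le> ?b"
    proof -
      have "?a + q = (s + k * q) div k" using k by simp
      also have "\<dots> \<le> ?b" using 2 q by (intro div_le_mono) simp
      finally show ?thesis .
    qed
    moreover have "?b < N" using sn p k by (intro less_mult_imp_div_less) (simp add: mult.commute)
    moreover have "run w q ?a (?b + 1 - ?a)"
      using run_block_seq_desubstitute[OF u, of w q s n] run 2 q by (simp add: k_def)
    ultimately have *: "real (?b + 1 - ?a) \<le> e * real q"
      using w[unfolded runs_bounded_def, rule_format, of q "?b + 1 - ?a" ?a] q1 by linarith
    have "n \<le> k * (?b + 1 - ?a)"
    proof -
      have "s + n - 1 < k * (?b + 1)" using k by (simp add: dividend_less_times_div)
      moreover have "k * ?a \<le> s" by simp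
      ultimately have "n \<le> k * (?b + 1) - k * ?a" using p by linarith
      then show ?thesis by (simp add: diff_mult_distrib2)
    qed
    then have "real n \<le> real k * real (?b + 1 - ?a)" by (metis of_nat_le_iff of_nat_mult)
    also have "\<dots> \<le> real k * (e * real q)" using * by (intro mult_left_mono) auto
    finally show ?thesis by (simp add: q mult_ac)
  next
    case 3
    have short: "n < p + L"
    proof (rule ccontr)
      assume "\<not> n < p + L"
      then have "s mod k = (s + p) mod k"
        using run sn by (intro sync) (auto simp: run_def add_ac)
      then show False using 3(2) by (metis add_diff_cancel_left' le_add1 mod_eq_dvd_iff_nat)
    qed
    show ?thesis
    proof (cases "p < L")
      case True
      have "n < 3 * p"
      proof (rule ccontr)
        assume "\<not> n < 3 * p"
        then have "run (block_seq u w) p s (3 * p)" using run by (auto simp: run_def)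
        moreover have "2 * p < L" "s + 3 * p \<le> k * N" using \<open>\<not> n < 3 * p\<close> short sn by auto
        ultimately show False using cubes p(1) 3(2) by blast
      qed
      then have "real n \<le> 3 * real p - 1" by linarith
      also have "\<dots> \<le> (3 - 1 / real L) * real p" using True L by (simp add: field_simps)
      also have "\<dots> \<le> e * real p" using e(2) by (intro mult_right_mono) auto
      finally show ?thesis .
    next
      case False
      then have "real n \<le> 2 * real p" using short by linarith
      also have "\<dots> \<le> e * real p" using e(1) by (intro mult_right_mono) auto
      finally show ?thesis .
    qed
  qed
qed

section \<open>The Thue-Morse morphism and composition\<close>

lemma block_seq_thue_morse:
  "block_seq [False, True] w (2 * i) = w i" "block_seq [False, True] w (Suc (2 * i)) = (\<not> w i)"
  by (simp_all add: block_seq_def numeral_2_eq_2[symmetric])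

text \<open>A factor occurring at an even and at an odd position is cut into pairs of distinct letters
  in both ways, so it alternates; six alternating letters come from three equal letters of \<open>w\<close>.\<close>
lemma thue_morse_factor_parity:
  fixes w :: "nat \<Rightarrow> bool"
  defines "x \<equiv> block_seq [False, True] w"
  assumes no_aaa: "\<And>s. s + 3 \<le> N \<Longrightarrow> \<not> run w 1 s 3"
    and "i + 6 \<le> 2 * N" "j + 6 \<le> 2 * N" and eq: "\<forall>t<6. x (i + t) = x (j + t)"
  shows "i mod 2 = j mod 2"
proof -
  have wlog: False if par: "even i" "odd j" and bound: "i + 6 \<le> 2 * N" and eq: "\<forall>t<6. x (i + t) = x (j + t)" for i j
  proof -
    obtain a b where ab: "i = 2 * a" "j = Suc (2 * b)" using par by (metis evenE oddE Suc_eq_plus1)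
    have X: "x (2 * c) = w c" "x (Suc (2 * c)) = (\<not> w c)" for c
      by (simp_all add: x_def block_seq_thue_morse)
    have "x (2 * a) = x (Suc (2 * b))" "x (Suc (2 * a)) = x (2 * Suc b)"
      "x (2 * Suc a) = x (Suc (2 * Suc b))" "x (Suc (2 * Suc a)) = x (2 * Suc (Suc b))"
      "x (2 * Suc (Suc a)) = x (Suc (2 * Suc (Suc b)))"
      using eq[rule_format, of 0] eq[rule_format, of 1] eq[rule_format, of 2] eq[rule_format, of 3]
        eq[rule_format, of 4] by (simp_all add: ab eval_nat_numeral)
    then have "w a = w (Suc a)" "w (Suc a) = w (Suc (Suc a))" unfolding X by blast+
    then have "run w 1 a 3" by (auto simp: run_def le_Suc_eq less_Suc_eq eval_nat_numeral)
    moreover have "a + 3 \<le> N" using bound ab by simp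
    ultimately show False using no_aaa by blast
  qed
  have "even i \<longleftrightarrow> even j"
    using wlog[of i j] wlog[of j i] assms(3,4) eq by auto
  then show ?thesis by (simp add: mod2_eq_if)
qed

lemma thue_morse_no_aaa:
  assumes "s + 3 \<le> 2 * N"
  shows "\<not> run (block_seq [False, True] w) 1 s 3"
proof
  assume *: "run (block_seq [False, True] w) 1 s 3"
  define a where "a = (s + 1) div 2"
  have "s \<le> 2 * a" "2 * a + 1 < s + 3" by (auto simp: a_def)
  then show False
    using *[unfolded run_def, rule_format, of "2 * a"] by (simp add: block_seq_thue_morse)
qed

lemma cubefree_block_thue_morse: "cubefree_block [False, True]"
  unfolding cubefree_block_def
proof (intro conjI exI[of _ "3 - 1 / 6"] allI impI)
  fix e :: real and w :: "nat \<Rightarrow> bool" and N assume e: "3 - 1 / 6 \<le> e" "e < 3" and w: "runs_bounded e w N"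
  have no_aaa: "\<not> run w 1 s 3" if "s + 3 \<le> N" for s
    using w[unfolded runs_bounded_def, rule_format, of 1 3 s] that e by auto
  have "runs_bounded e (block_seq [False, True] w) (length [False, True] * N)"
  proof (rule runs_bounded_block_seq[where L = 6])
    fix i j assume "i + 6 \<le> length [False, True] * N" "j + 6 \<le> length [False, True] * N"
      "\<forall>t<6. block_seq [False, True] w (i + t) = block_seq [False, True] w (j + t)"
    then show "i mod length [False, True] = j mod length [False, True]"
      using thue_morse_factor_parity[of N w i j] no_aaa by (simp add: numeral_2_eq_2)
  next
    fix p s assume "1 \<le> p" "2 * p < 6" "\<not> length [False, True] dvd p" "s + 3 * p \<le> length [False, True] * N"
    then have "odd p" "p < 3" by (simp_all add: numeral_2_eq_2)
    then have "p = 1" by (auto elim!: oddE)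
    then show "\<not> run (block_seq [False, True] w) p s (3 * p)" using thue_morse_no_aaa[of s "s + 3" w] by simp
  qed (use e w in auto)
  then show "runs_bounded e (block_seq [False, True] w) (length [False, True] * N)" .
qed auto

lemma block_seq_block_map:
  assumes "u \<noteq> []" "v \<noteq> []"
  shows "block_seq (block_map u v) w i = block_seq u (block_seq v w) i"
proof -
  let ?k = "length u" and ?l = "length v"
  let ?i = "i mod (?k * ?l)"
  have "?i < ?k * ?l" using assms by simp
  then have "block_map u v ! ?i = (u ! (?i mod ?k) \<noteq> v ! (?i div ?k))"
    by (simp add: nth_block_map block_seq_def)
  moreover have "?i mod ?k = i mod ?k" by (simp add: mod_mult2_eq)
  moreover have "?i div ?k = (i div ?k) mod ?l" using assms by (simp add: mod_mult2_eq)
  ultimately show ?thesis by (auto simp: block_seq_def div_mult2_eq)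
qed

lemma cubefree_block_block_map:
  assumes "cubefree_block u" "cubefree_block v"
  shows "cubefree_block (block_map u v)"
proof -
  obtain c where u: "u \<noteq> []" and c: "c < 3" "\<And>e w N. c \<le> e \<Longrightarrow> e < 3 \<Longrightarrow> runs_bounded e w N \<Longrightarrow>
      runs_bounded e (block_seq u w) (length u * N)"
    using assms(1) unfolding cubefree_block_def by blast
  obtain d where v: "v \<noteq> []" and d: "d < 3" "\<And>e w N. d \<le> e \<Longrightarrow> e < 3 \<Longrightarrow> runs_bounded e w N \<Longrightarrow>
      runs_bounded e (block_seq v w) (length v * N)"
    using assms(2) unfolding cubefree_block_def by blast
  have "block_seq (block_map u v) w = block_seq u (block_seq v w)" for w
    using u v by (simp add: block_seq_block_map fun_eq_iff)
  moreover have "block_map u v \<noteq> []" using u v by (metis length_block_map length_0_conv mult_is_0)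
  ultimately show ?thesis using c d unfolding cubefree_block_def
    by (intro conjI exI[of _ "max c d"]) (auto simp: mult.assoc)
qed

section \<open>Markers\<close>

lemma block_seq_at:
  assumes "i < length u"
  shows "block_seq u w (length u * j + i) \<longleftrightarrow> u ! i \<noteq> w j"
proof -
  have "length u \<noteq> 0" using assms by auto
  then show ?thesis using assms div_mult_self4[of "length u" j i] by (simp add: block_seq_def)
qed

text \<open>Three consecutive blocks, normalised so that the first of them is not flipped. As the flip of the
  first block is arbitrary, finite checks are only needed for words starting with the letter 0.\<close>
lemma block_seq_local:
  assumes "u \<noteq> []"
  shows "\<exists>a b. \<forall>i<3 * length u.
    block_seq u w (length u * j + i) \<longleftrightarrow> block_map u [False, a, b] ! i \<noteq> w j"
proof (intro exI allI impI)
  fix i assume i: "i < 3 * length u"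
  have "i div length u < 3" using i by (simp add: less_mult_imp_div_less)
  then have "i div length u = 0 \<or> i div length u = 1 \<or> i div length u = 2" by linarith
  then show "block_seq u w (length u * j + i) \<longleftrightarrow>
      block_map u [False, w (j + 1) \<noteq> w j, w (j + 2) \<noteq> w j] ! i \<noteq> w j"
    using assms i by (auto simp: nth_block_map block_seq_def mult.commute)
qed

text \<open>The block ends in a marker \<open>m\<close> that reveals the block boundaries: up to complement, \<open>m\<close> occurs in
  images only at the end of a block. A factor of length \<open>length u + length m - 1\<close> contains a
  marker, which gives the synchronisation required above. A cube of period \<open>p \<ge> length m\<close> that contains
  a marker contains a second copy at distance \<open>p\<close>, so \<open>p\<close> is a multiple of the block length.
  Hence a cube whose period is not one is either shorter than \<open>3 * length m\<close> or lies strictly between the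
  start of one marker and the end of the next; these are the cubes of the hypotheses \<open>short\<close> and
  \<open>long\<close>.\<close>
lemma cubefree_block_marker:
  fixes t m :: "bool list"
  defines "u \<equiv> t @ m"
  defines "k \<equiv> length u"
  assumes m: "m \<noteq> []"
    and marker: "\<And>w s d. (\<forall>i<length m. block_seq u w (s + i) \<longleftrightarrow> m ! i \<noteq> d) \<Longrightarrow> s mod k = length t"
    and short: "\<And>w s p. 1 \<le> p \<Longrightarrow> p < length m \<Longrightarrow> \<not> run (block_seq u w) p s (3 * p)"
    and long: "\<And>w s p. length m \<le> p \<Longrightarrow> length t < s \<Longrightarrow> s + 3 * p < 2 * k \<Longrightarrow>
      \<not> run (block_seq u w) p s (3 * p)"
  shows "cubefree_block u"
  unfolding cubefree_block_def
proof (intro conjI exI allI impI)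
  let ?c = "length m" and ?n = "length t"
  let ?L = "k + ?c - 1"
  have c: "?c \<ge> 1" using m by (cases m) auto
  have k: "k = ?n + ?c" "k > 0" using c by (auto simp: k_def u_def)
  have nk: "?n < k" using k(1) c by linarith
  show u: "u \<noteq> []" using m by (simp add: u_def)
  show "max 2 (3 - 1 / real ?L) < 3" using k c by (simp add: field_simps)
  have mark: "block_seq u w (q + i) \<longleftrightarrow> m ! i \<noteq> w (q div k)" if "q mod k = ?n" "i < ?c" for w q i
  proof -
    have q: "q + i = k * (q div k) + (?n + i)" using that by (metis add.assoc div_mult_mod_eq mult.commute)
    have "(q + i) mod k = ?n + i" "(q + i) div k = q div k"
      unfolding q using that k by auto
    then show ?thesis by (simp add: block_seq_def k_def[symmetric]) (simp add: u_def)
  qed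
  fix e :: real and w :: "nat \<Rightarrow> bool" and N
  assume e: "max 2 (3 - 1 / real ?L) \<le> e" "e < 3" and w: "runs_bounded e w N"
  have "runs_bounded e (block_seq u w) (length u * N)"
  proof (rule runs_bounded_block_seq[where L = ?L])
    fix i j assume *: "\<forall>t<?L. block_seq u w (i + t) = block_seq u w (j + t)"
    \<comment> \<open>From position \<open>i\<close> it takes \<open>r\<close> steps to reach the next marker.\<close>
    define r where "r = (k + ?n - i mod k) mod k"
    have r: "r < k" using k by (simp add: r_def)
    have "(i + r) mod k = (i mod k + (k + ?n - i mod k)) mod k" unfolding r_def by (simp add: mod_simps)
    also have "i mod k + (k + ?n - i mod k) = k + ?n" using k by (simp add: less_imp_le trans_le_add1)
    also have "(k + ?n) mod k = ?n" using nk by simp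
    finally have ir: "(i + r) mod k = ?n" .
    have "\<forall>x<?c. block_seq u w (j + r + x) \<longleftrightarrow> m ! x \<noteq> w ((i + r) div k)"
    proof (intro allI impI)
      fix x assume x: "x < ?c"
      then have "r + x < ?L" using r by simp
      then show "block_seq u w (j + r + x) \<longleftrightarrow> m ! x \<noteq> w ((i + r) div k)"
        using * mark[OF ir x, of w] by (simp add: add.assoc)
    qed
    then have "(j + r) mod k = (i + r) mod k" using marker ir by simp
    then have "(j + r + (k - r)) mod k = (i + r + (k - r)) mod k" by (rule mod_add_cong) simp
    then show "i mod length u = j mod length u" using r by (simp add: k_def)
  next
    fix p s assume p: "1 \<le> p" "2 * p < ?L" "\<not> length u dvd p"
    show "\<not> run (block_seq u w) p s (3 * p)"
    proof (cases "p < ?c")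
      case True
      then show ?thesis using short p by simp
    next
      case False
      show ?thesis
      proof
        assume run: "run (block_seq u w) p s (3 * p)"
        have no_marker: "q < s \<or> s + 3 * p < q + ?c" if q: "q mod k = ?n" for q
        proof (rule ccontr)
          assume "\<not> (q < s \<or> s + 3 * p < q + ?c)"
          then have q': "s \<le> q" "q + ?c \<le> s + 3 * p" by auto
          consider "q + p + ?c \<le> s + 3 * p" | "s + p \<le> q" using False by linarith
          then have "\<exists>q'. (\<forall>i<?c. block_seq u w (q' + i) = block_seq u w (q + i)) \<and> (q' = q + p \<or> q = q' + p)"
          proof cases
            case 1
            then show ?thesis using run q' by (intro exI[of _ "q + p"]) (auto simp: run_def add_ac)
          next
            case 2
            have "block_seq u w (q - p + i) = block_seq u w (q + i)" if "i < ?c" for i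
              using run[unfolded run_def, rule_format, of "q - p + i"] 2 q' that by auto
            then show ?thesis using 2 by (intro exI[of _ "q - p"]) auto
          qed
          then obtain q'' where q'': "\<forall>i<?c. block_seq u w (q'' + i) = block_seq u w (q + i)"
            "q'' = q + p \<or> q = q'' + p" by blast
          then have "q'' mod k = q mod k" using marker[of w q'' "w (q div k)"] mark[OF q] q by auto
          then have "k dvd p" using q''(2)
            by (metis add_diff_cancel_left' le_add1 mod_eq_dvd_iff_nat)
          then show False using p(3) by (simp add: k_def)
        qed
        \<comment> \<open>A shift by whole blocks lets the cube start after the beginning of the marker of block 0,
          but not after the beginning of the next marker. One block is first added in front, since the cube may start before the
          first marker.\<close>
        define J where "J = (s + k - ?n - 1) div k"
        define s' where "s' = s + k - k * J"
        define w' where "w' = (\<lambda>q. w (q + J - 1))"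
        have "k * J \<le> s + k - ?n - 1" "s + k - ?n - 1 < k * J + k"
          unfolding J_def using dividend_less_times_div[OF k(2)] by (simp_all add: add.commute)
        then have s': "?n < s'" "s' \<le> ?n + k" "s' + k * J = s + k" using k c by (auto simp: s'_def)
        have shift: "block_seq u w' i = block_seq u w j" if "j + k = i + k * J" for i j
        proof -
          have "j mod k = i mod k" "j div k + 1 = i div k + J"
            using arg_cong[OF that, of "\<lambda>x. x mod k"] arg_cong[OF that, of "\<lambda>x. x div k"] k(2) by simp_all
          then have "j mod k = i mod k" "j div k = i div k + J - 1" by linarith+
          then show ?thesis by (simp add: block_seq_def k_def[symmetric] w'_def)
        qed
        have "s' + 3 * p < 2 * k"
        proof -
          have "(?n + k * J) mod k = ?n" using nk by simp
          moreover have "s \<le> ?n + k * J" using s' by linarith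
          ultimately show ?thesis using no_marker[of "?n + k * J"] s' k by linarith
        qed
        moreover have "run (block_seq u w') p s' (3 * p)"
          unfolding run_def
        proof (intro allI impI)
          fix i assume i: "s' \<le> i" "i + p < s' + 3 * p"
          define j where "j = i + k * J - k"
          have j: "j + k = i + k * J" "s \<le> j" using i s' by (auto simp: j_def)
          then have "block_seq u w j = block_seq u w (j + p)"
            using run[unfolded run_def, rule_format, of j] i s' by simp
          then show "block_seq u w' i = block_seq u w' (i + p)"
            using shift[of j i] shift[of "j + p" "i + p"] j by simp
        qed
        ultimately show False using long[of p s' w'] s' False by simp
      qed
    qed
  next
    show "2 \<le> e" "3 - 1 / real ?L \<le> e" using e(1) by (simp_all only: max.bounded_iff)
  qed (use u w k c in auto)
  then show "runs_bounded e (block_seq u w) (length u * N)" .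
qed

section \<open>The Thue-Morse sequence\<close>

fun thue_morse :: "nat \<Rightarrow> bool" where
  "thue_morse n = (if n = 0 then False else thue_morse (n div 2) \<noteq> odd n)"

declare thue_morse.simps [simp del]

lemma thue_morse_double: "thue_morse (2 * n) = thue_morse n" "thue_morse (Suc (2 * n)) = (\<not> thue_morse n)"
  by (subst thue_morse.simps; cases "n = 0"; simp add: thue_morse.simps[of 0])+

lemma block_seq_thue_morse_fixpoint: "block_seq [False, True] thue_morse = thue_morse"
proof
  fix n show "block_seq [False, True] thue_morse n = thue_morse n"
    by (cases "even n") (auto elim!: evenE oddE simp: block_seq_thue_morse thue_morse_double)
qed

lemma run_subset: "run x p s n \<Longrightarrow> s \<le> s' \<Longrightarrow> s' + n' \<le> s + n \<Longrightarrow> run x p s' n'"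
  unfolding run_def by auto

text \<open>The proof descends along the fixed point equation: an even period can be halved, and an odd
  period \<open>p \<ge> 5\<close> contradicts parity, because the overlap contains a factor of length 6 repeated at an
  odd distance. Periods 1 and 3 are too short for that argument and are settled letter by letter.\<close>
lemma thue_morse_overlap_free: "p \<ge> 1 \<Longrightarrow> \<not> run thue_morse p s (2 * p + 1)"
proof (induction p arbitrary: s rule: less_induct)
  case (less p)
  have aaa: "\<not> run thue_morse 1 s 3" for s
    using thue_morse_no_aaa[of s "s + 3" thue_morse] by (simp add: block_seq_thue_morse_fixpoint)
  show ?case
  proof
    assume run: "run thue_morse p s (2 * p + 1)"
    consider q where "p = 2 * q" | "p = 1" | "p = 3" | "odd p" "p \<ge> 5"
    proof -
      have "even p \<or> p = 1 \<or> p = 3 \<or> odd p \<and> p \<ge> 5" using less.prems by presburger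
      then show thesis using that by (auto elim!: evenE)
    qed
    then show False
    proof cases
      case 1
      then have "run thue_morse q (s div 2) ((s + (4 * q + 1) - 1) div 2 + 1 - s div 2)"
        using run_block_seq_desubstitute[of "[False, True]" thue_morse q s "4 * q + 1"] run
        by (simp add: block_seq_thue_morse_fixpoint numeral_2_eq_2[symmetric])
      moreover have "(s + (4 * q + 1) - 1) div 2 + 1 - s div 2 = 2 * q + 1"
        using div_mult_self2[of 2 s "2 * q"] by simp
      ultimately show False using less 1 by auto
    next
      case 2 then show False using run aaa by simp
    next
      case 3
      have *: "thue_morse (s + i) = thue_morse (s + i + 3)" if "i < 4" for i
        using run that 3 unfolding run_def by auto
      show False
      proof (cases "even s")
        case True
        then obtain a where "s = 2 * a" by blast
        then show False using *[of 0] *[of 1] *[of 2] *[of 3]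
            thue_morse_double[of a] thue_morse_double[of "Suc a"] thue_morse_double[of "Suc (Suc a)"] thue_morse_double[of "Suc (Suc (Suc a))"]
          by (simp add: eval_nat_numeral)
      next
        case False
        then obtain a where "s = Suc (2 * a)" by (metis oddE Suc_eq_plus1)
        then show False using *[of 0] *[of 1] *[of 2] *[of 3]
            thue_morse_double[of a] thue_morse_double[of "Suc a"] thue_morse_double[of "Suc (Suc a)"] thue_morse_double[of "Suc (Suc (Suc a))"]
          by (simp add: eval_nat_numeral)
      qed
    next
      case 4
      have "\<forall>t<6. thue_morse (s + t) = thue_morse (s + p + t)" using run 4(2) by (auto simp: run_def add_ac)
      then have "s mod 2 = (s + p) mod 2"
        using thue_morse_factor_parity[of "s + p + 6" thue_morse s "s + p"] aaa
        by (simp add: block_seq_thue_morse_fixpoint)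
      then show False using 4(1) by presburger
    qed
  qed
qed

section \<open>Checking a marker by computation\<close>

text \<open>Scans two lists in parallel and fails as soon as \<open>g\<close> consecutive positions agree. The counter \<open>r\<close> is
  the number of agreements that are still missing. Applied to a word and its shift by \<open>p\<close> with
  \<open>g = 2 * p\<close>, it looks for cubes of period \<open>p\<close> in linear time.\<close>
fun agreement_free :: "nat \<Rightarrow> nat \<Rightarrow> bool list \<Rightarrow> bool list \<Rightarrow> bool" where
  "agreement_free g 0 xs ys = False"
| "agreement_free g (Suc r) (x # xs) (y # ys) = agreement_free g (if x = y then r else g) xs ys"
| "agreement_free g (Suc r) _ _ = True"

definition no_cube :: "bool list \<Rightarrow> nat \<Rightarrow> bool" where
  "no_cube w p = agreement_free (2 * p) (2 * p) w (drop p w)"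

lemma agreement_free_sound:
  assumes "agreement_free g r xs ys" "r \<le> g"
  shows "r \<le> length xs \<Longrightarrow> r \<le> length ys \<Longrightarrow> \<exists>i<r. xs ! i \<noteq> ys ! i"
    and "j + g \<le> length xs \<Longrightarrow> j + g \<le> length ys \<Longrightarrow> \<exists>i<g. xs ! (j + i) \<noteq> ys ! (j + i)"
proof -
  have "(r \<le> length xs \<longrightarrow> r \<le> length ys \<longrightarrow> (\<exists>i<r. xs ! i \<noteq> ys ! i)) \<and>
    (\<forall>j. j + g \<le> length xs \<longrightarrow> j + g \<le> length ys \<longrightarrow> (\<exists>i<g. xs ! (j + i) \<noteq> ys ! (j + i)))"
    using assms
  proof (induction g r xs ys rule: agreement_free.induct)
    case (2 g r x xs y ys)
    show ?case
    proof (cases "x = y")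
      case True
      then have IH: "r \<le> length xs \<Longrightarrow> r \<le> length ys \<Longrightarrow> \<exists>i<r. xs ! i \<noteq> ys ! i"
        "\<And>j. j + g \<le> length xs \<Longrightarrow> j + g \<le> length ys \<Longrightarrow> \<exists>i<g. xs ! (j + i) \<noteq> ys ! (j + i)"
        using 2 by auto
      have first: "\<exists>i<Suc r. (x # xs) ! i \<noteq> (y # ys) ! i" if "r \<le> length xs" "r \<le> length ys"
        using IH(1)[OF that] by (metis Suc_mono nth_Cons_Suc)
      have "\<exists>i<g. (x # xs) ! (j + i) \<noteq> (y # ys) ! (j + i)"
        if "j + g \<le> Suc (length xs)" "j + g \<le> Suc (length ys)" for j
      proof (cases j)
        case 0
        then show ?thesis using first that 2(3) by (metis add_0 le_trans less_le_trans not_less_eq_eq Suc_le_mono)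
      next
        case (Suc j')
        then show ?thesis using IH(2)[of j'] that by simp
      qed
      then show ?thesis using first by simp
    next
      case False
      then have IH: "\<And>j. j + g \<le> length xs \<Longrightarrow> j + g \<le> length ys \<Longrightarrow> \<exists>i<g. xs ! (j + i) \<noteq> ys ! (j + i)"
        using 2 by auto
      have "\<exists>i<g. (x # xs) ! (j + i) \<noteq> (y # ys) ! (j + i)"
        if "j + g \<le> Suc (length xs)" "j + g \<le> Suc (length ys)" for j
      proof (cases j)
        case 0
        then show ?thesis using False 2(3) by (intro exI[of _ 0]) auto
      next
        case (Suc j')
        then show ?thesis using IH[of j'] that by simp
      qed
      then show ?thesis using False by (auto intro!: exI[of _ 0])
    qed
  qed auto
  then show "r \<le> length xs \<Longrightarrow> r \<le> length ys \<Longrightarrow> \<exists>i<r. xs ! i \<noteq> ys ! i"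
    and "j + g \<le> length xs \<Longrightarrow> j + g \<le> length ys \<Longrightarrow> \<exists>i<g. xs ! (j + i) \<noteq> ys ! (j + i)" by blast+
qed

lemma no_cube_imp_not_run:
  assumes "no_cube v p" "r + 3 * p \<le> length v"
    and x: "\<And>i. i < 3 * p \<Longrightarrow> x (s + i) \<longleftrightarrow> v ! (r + i) \<noteq> d"
  shows "\<not> run x p s (3 * p)"
proof
  assume run: "run x p s (3 * p)"
  have "\<exists>i<2 * p. v ! (r + i) \<noteq> drop p v ! (r + i)"
    by (rule agreement_free_sound(2)[of "2 * p" "2 * p" v "drop p v" r])
      (use assms(1,2) in \<open>auto simp: no_cube_def\<close>)
  then obtain i where i: "i < 2 * p" "v ! (r + i) \<noteq> drop p v ! (r + i)" by blast
  then have "v ! (r + i) \<noteq> v ! (r + (i + p))" using assms(2) by (simp add: add_ac)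
  moreover have "x (s + i) = x (s + (i + p))"
    using run[unfolded run_def, rule_format, of "s + i"] i(1) by (simp add: add.assoc)
  moreover have "x (s + i) \<longleftrightarrow> v ! (r + i) \<noteq> d" "x (s + (i + p)) \<longleftrightarrow> v ! (r + (i + p)) \<noteq> d"
    by (rule x; use i(1) in simp)+
  ultimately show False by argo
qed

fun agrees :: "bool \<Rightarrow> bool list \<Rightarrow> bool list \<Rightarrow> bool" where
  "agrees d [] v = True"
| "agrees d (a # m) [] = False"
| "agrees d (a # m) (b # v) = (if b = (a \<noteq> d) then agrees d m v else False)"

text \<open>A position is marked if \<open>m\<close> or its complement occurs there; a marker is sought up to complement
  because blocks appear in images up to complement.\<close>
fun occurrences :: "bool list \<Rightarrow> bool list \<Rightarrow> bool list" where
  "occurrences m [] = []"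
| "occurrences m (x # v) = (agrees False m (x # v) \<or> agrees True m (x # v)) # occurrences m v"

lemma agreesI:
  "length m \<le> length v \<Longrightarrow> (\<And>i. i < length m \<Longrightarrow> v ! i \<longleftrightarrow> m ! i \<noteq> d) \<Longrightarrow> agrees d m v"
proof (induction d m v rule: agrees.induct)
  case (3 d a m b v)
  have head: "b = (a \<noteq> d)" using "3.prems"(2)[of 0] by simp
  moreover have "agrees d m v"
  proof (rule "3.IH"[OF head])
    show "v ! i \<longleftrightarrow> m ! i \<noteq> d" if "i < length m" for i using "3.prems"(2)[of "Suc i"] that by simp
  qed (use "3.prems"(1) in simp)
  ultimately show ?case by simp
qed auto

lemma length_occurrences [simp]: "length (occurrences m v) = length v"
  by (induction v) auto

lemma nth_occurrences:
  "r < length v \<Longrightarrow> occurrences m v ! r \<longleftrightarrow> agrees False m (drop r v) \<or> agrees True m (drop r v)"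
  by (induction v arbitrary: r) (auto simp: nth_Cons' drop_Cons')

lemma occurrencesI:
  assumes "r + length m \<le> length v" "r < length v"
    and "\<And>i. i < length m \<Longrightarrow> v ! (r + i) \<longleftrightarrow> m ! i \<noteq> d"
  shows "occurrences m v ! r"
proof -
  have "agrees d m (drop r v)" using assms by (intro agreesI) auto
  then show ?thesis using assms(2) by (cases d) (auto simp: nth_occurrences)
qed

definition cubeless :: "bool list \<Rightarrow> nat \<Rightarrow> nat \<Rightarrow> bool" where
  "cubeless v a b \<longleftrightarrow> list_all (no_cube v) [a..<b]"

text \<open>A named predicate with the word as its last argument: mapped over a list of words by
  rewriting, it is unfolded only after each word has been evaluated.\<close>
definition window_ok :: "bool list \<Rightarrow> nat \<Rightarrow> nat \<Rightarrow> bool list \<Rightarrow> bool" where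
  "window_ok m n N v \<longleftrightarrow>
    take N (occurrences m v) = replicate n False @ True # replicate (N - Suc n) False \<and>
    cubeless v 1 (length m)"

lemma cubelessD: "cubeless v a b \<Longrightarrow> a \<le> p \<Longrightarrow> p < b \<Longrightarrow> no_cube v p"
  by (simp add: cubeless_def list_all_iff)

lemma window_okD:
  assumes "window_ok m n N v"
  shows "occurrences m v ! r \<Longrightarrow> r < N \<Longrightarrow> r = n"
    and "1 \<le> p \<Longrightarrow> p < length m \<Longrightarrow> no_cube v p"
proof -
  assume r: "occurrences m v ! r" "r < N"
  have "take N (occurrences m v) ! r" using r by simp
  then have *: "(replicate n False @ True # replicate (N - Suc n) False) ! r"
    using assms by (simp only: window_ok_def)
  show "r = n"
  proof (rule ccontr)
    assume "r \<noteq> n"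
    then consider "r < n" | i where "r = Suc (n + i)" by (metis less_imp_Suc_add linorder_neqE_nat)
    then show False using * r(2) by cases (simp_all add: nth_append)
  qed
next
  show "1 \<le> p \<Longrightarrow> p < length m \<Longrightarrow> no_cube v p"
    using assms cubelessD[of v 1 "length m" p] by (simp add: window_ok_def)
qed

text \<open>The marker criterion in a form that can be evaluated. Short cubes fit into three blocks because of
  the bound on \<open>length m\<close>; a cube between two markers fits into a marker followed by a block.\<close>
definition marker_ok :: "bool list \<Rightarrow> bool list \<Rightarrow> bool" where
  "marker_ok t m \<longleftrightarrow> (let u = t @ m in
    m \<noteq> [] \<and> 3 * length m \<le> 2 * length u + 4 \<and>
    list_all (window_ok m (length t) (length u))
      (map (block_map u) [[False, False, False], [False, False, True], [False, True, False], [False, True, True]]) \<and>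
    cubeless (m @ block_map u [False]) (length m) (length u) \<and>
    cubeless (m @ block_map u [True]) (length m) (length u))"

lemma cubefree_block_if_marker_ok:
  assumes ok: "marker_ok t m"
  shows "cubefree_block (t @ m)"
proof (rule cubefree_block_marker)
  let ?u = "t @ m" and ?c = "length m"
  let ?k = "length ?u"
  show m: "m \<noteq> []" using ok by (simp add: marker_ok_def Let_def)
  then have k: "?k > 0" by simp
  have c: "3 * ?c \<le> 2 * ?k + 4" using ok by (simp add: marker_ok_def Let_def)
  have window: "window_ok m (length t) ?k (block_map ?u [False, a, b])" for a b
    using ok by (cases a; cases b) (simp_all add: marker_ok_def Let_def)
  have long: "no_cube (m @ block_map ?u [a]) p" if "?c \<le> p" "p < ?k" for a p
    using ok that by (cases a) (auto simp: marker_ok_def Let_def intro: cubelessD)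
  fix w s
  define r j where "r = s mod ?k" and "j = s div ?k"
  have r: "s = ?k * j + r" "r < ?k" using k by (auto simp: r_def j_def)
  obtain a b where ab: "\<And>i. i < 3 * ?k \<Longrightarrow>
      block_seq ?u w (?k * j + i) \<longleftrightarrow> block_map ?u [False, a, b] ! i \<noteq> w j"
    using block_seq_local[of ?u w j] m by auto
  show "s mod ?k = length t" if d: "\<forall>i<?c. block_seq ?u w (s + i) \<longleftrightarrow> m ! i \<noteq> d" for d
  proof -
    have "occurrences m (block_map ?u [False, a, b]) ! r"
    proof (rule occurrencesI[where d = "d \<noteq> w j"])
      fix i assume i: "i < ?c"
      have "block_seq ?u w (s + i) \<longleftrightarrow> block_map ?u [False, a, b] ! (r + i) \<noteq> w j"
        unfolding r(1) add.assoc using r(2) i by (intro ab) simp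
      moreover have "block_seq ?u w (s + i) \<longleftrightarrow> m ! i \<noteq> d" using d i by blast
      ultimately show "block_map ?u [False, a, b] ! (r + i) \<longleftrightarrow> m ! i \<noteq> (d \<noteq> w j)" by argo
    qed (use r(2) in simp_all)
    then show ?thesis using window_okD(1)[OF window] r(2) by (simp add: r_def)
  qed
  fix p
  show "\<not> run (block_seq ?u w) p s (3 * p)" if p: "1 \<le> p" "p < ?c"
  proof (rule no_cube_imp_not_run[OF window_okD(2)[OF window p]])
    show "r + 3 * p \<le> length (block_map ?u [False, a, b])" using r(2) p c by simp
    then show "block_seq ?u w (s + i) \<longleftrightarrow> block_map ?u [False, a, b] ! (r + i) \<noteq> w j" if "i < 3 * p" for i
      unfolding r(1) add.assoc using that by (intro ab) simp
  qed
  show "\<not> run (block_seq ?u w) p s (3 * p)" if p: "?c \<le> p" "length t < s" "s + 3 * p < 2 * ?k"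
  proof (rule no_cube_imp_not_run[OF long])
    show "?c \<le> p" "p < ?k" using p by auto
    show "s - length t + 3 * p \<le> length (m @ block_map ?u [w 1 \<noteq> w 0])" using p by simp
    fix i assume i: "i < 3 * p"
    define y where "y = s - length t + i"
    have y: "s + i = length t + y" "y < ?c + ?k" using p i by (auto simp: y_def)
    have "block_seq ?u w (length t + y) \<longleftrightarrow> (m @ block_map ?u [w 1 \<noteq> w 0]) ! y \<noteq> w 0"
    proof (cases "y < ?c")
      case True
      then show ?thesis by (simp add: block_seq_def nth_append)
    next
      case False
      then obtain z where z: "y = ?c + z" using le_Suc_ex by (metis not_less)
      then have "length t + y = z + ?k" "z < ?k" using y by auto
      then have "(length t + y) mod ?k = z" "(length t + y) div ?k = 1"
        using m by (simp_all del: length_append)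
      then have "block_seq ?u w (length t + y) \<longleftrightarrow> ?u ! z \<noteq> w 1" by (simp only: block_seq_def)
      moreover have "block_map ?u [w 1 \<noteq> w 0] ! z \<longleftrightarrow> ?u ! z \<noteq> (w 1 \<noteq> w 0)"
        using \<open>z < ?k\<close> by (simp add: nth_block_map block_seq_def)
      ultimately show ?thesis by (auto simp: z nth_append)
    qed
    then show "block_seq ?u w (s + i) \<longleftrightarrow> (m @ block_map ?u [w 1 \<noteq> w 0]) ! (s - length t + i) \<noteq> w 0"
      by (simp add: y(1) y_def[symmetric])
  qed
qed

section \<open>Thue-Morse words with a marker\<close>

definition bits :: "string \<Rightarrow> bool list" where
  "bits s = map (\<lambda>c. c = CHR ''1'') s"

definition thue_morse_block :: "bool list" where
  "thue_morse_block =
    [False, True, True, False, True, False, False, True,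
     True, False, False, True, False, True, True, False,
     True, False, False, True, False, True, True, False,
     False, True, True, False, True, False, False, True]"

lemma thue_morse_block_eq: "thue_morse_block = map thue_morse [0..<32]"
  by code_simp

text \<open>The Thue-Morse sequence is also fixed by the fifth power of its morphism, of block length 32.
  So each of its factors of length at most 33 lies in one of four words of length 64.\<close>
lemma block_seq_thue_morse_block: "block_seq thue_morse_block thue_morse = thue_morse"
proof
  have pow: "thue_morse (2 ^ j * q + y) \<longleftrightarrow> thue_morse y \<noteq> thue_morse q" if "y < 2 ^ j" for j q y
    using that
  proof (induction j arbitrary: y)
    case (Suc j)
    show ?case
    proof (cases "even y")
      case True
      then obtain z where z: "y = 2 * z" by blast
      then have "2 ^ Suc j * q + y = 2 * (2 ^ j * q + z)" by simp
      moreover have "z < 2 ^ j" using Suc.prems z by simp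
      ultimately show ?thesis using Suc.IH z by (simp only: thue_morse_double)
    next
      case False
      then obtain z where z: "y = Suc (2 * z)" by (metis oddE Suc_eq_plus1)
      then have "2 ^ Suc j * q + y = Suc (2 * (2 ^ j * q + z))" by simp
      moreover have "z < 2 ^ j" using Suc.prems z by simp
      ultimately show ?thesis using Suc.IH z by (simp only: thue_morse_double) blast
    qed
  qed (simp add: thue_morse.simps[of 0])
  fix i
  have "thue_morse i \<longleftrightarrow> thue_morse (i mod 32) \<noteq> thue_morse (i div 32)" using pow[of "i mod 32" 5 "i div 32"] by simp
  then show "block_seq thue_morse_block thue_morse i = thue_morse i" by (simp add: block_seq_def thue_morse_block_eq)
qed

lemma thue_morse_window:
  "y < 64 \<Longrightarrow> thue_morse (32 * q + y) = block_map thue_morse_block [thue_morse q, thue_morse (q + 1)] ! y"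
proof -
  assume y: "y < 64"
  have len: "length thue_morse_block = 32" by (simp add: thue_morse_block_eq)
  have "y div 32 = 0 \<or> y div 32 = 1" using y by linarith
  moreover have "thue_morse (32 * q + y) = block_seq thue_morse_block thue_morse (32 * q + y)" by (simp add: block_seq_thue_morse_block)
  ultimately show ?thesis using y by (auto simp: nth_block_map block_seq_def len)
qed

text \<open>The surroundings of a marker in a block \<open>t @ m\<close> whose part \<open>t\<close> consists of the Thue-Morse letters
  from position \<open>a\<close> on: the last \<open>W\<close> letters of \<open>t\<close>, the marker, and the first \<open>W\<close> letters of the next
  block, complemented if \<open>b\<close>. Here \<open>W\<close> exceeds by one the largest number of letters outside the marker
  of a cube of period below \<open>length m\<close> that meets the marker.
  The end of \<open>t\<close> is cut out of two consecutive images of \<open>b1\<close> and \<open>b2\<close> such that it ends at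
  position \<open>r + 36\<close>, which leaves at least 36 letters to its left and stays within 64 for
  \<open>r \<le> 28\<close>. The word starting the next block is taken from the images of 0 and 1, the first letters of the Thue-Morse sequence.\<close>
definition junction :: "nat \<Rightarrow> bool list \<Rightarrow> nat \<Rightarrow> bool \<Rightarrow> bool \<Rightarrow> bool \<Rightarrow> bool list" where
  "junction a m r b1 b2 b = (let W = 3 * (length m - 1) in
     take W (drop (r + 36 - W) (block_map thue_morse_block [b1, b2])) @ m @ take W (drop a (block_map thue_morse_block [b, \<not> b])))"

text \<open>The end of \<open>t\<close> is at a multiple of 4, so only eight values of \<open>r\<close> arise.\<close>
definition junction_ok :: "nat \<Rightarrow> bool list \<Rightarrow> bool" where
  "junction_ok a m \<longleftrightarrow>
    list_all (window_ok m (3 * (length m - 1)) (Suc (6 * (length m - 1))))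
      [junction a m r b1 b2 b. r \<leftarrow> [0, 4, 8, 12, 16, 20, 24, 28],
         b1 \<leftarrow> [False, True], b2 \<leftarrow> [False, True], b \<leftarrow> [False, True]] \<and>
    list_all (\<lambda>v. take 32 (occurrences m v) = replicate 32 False)
      [block_map thue_morse_block [b1, b2]. b1 \<leftarrow> [False, True], b2 \<leftarrow> [False, True]]"

lemma run_within_thue_morse_part:
  assumes "length t = n" "\<And>i. i < n \<Longrightarrow> t ! i = thue_morse (a + i)"
    and "length (t @ m) * j \<le> s" "s + l \<le> length (t @ m) * j + n"
    and run: "run (block_seq (t @ m) w) p s l"
  shows "run thue_morse p (a + (s - length (t @ m) * j)) l"
  unfolding run_def
proof (intro allI impI)
  let ?k = "length (t @ m)"
  have eq: "block_seq (t @ m) w (?k * j + i) \<longleftrightarrow> thue_morse (a + i) \<noteq> w j" if "i < n" for i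
    using that assms(1,2) block_seq_at[of i "t @ m" w j] by (simp add: nth_append)
  fix i assume i: "a + (s - ?k * j) \<le> i" "i + p < a + (s - ?k * j) + l"
  then have "?k * j + (i - a) + p < s + l" "s \<le> ?k * j + (i - a)" "i - a + p < n" "a \<le> i"
    using assms(3,4) by auto
  then show "thue_morse i = thue_morse (i + p)"
    using run[unfolded run_def, rule_format, of "?k * j + (i - a)"] eq[of "i - a"] eq[of "i - a + p"]
    by (simp add: add.assoc) argo
qed

text \<open>One finite check serves infinitely many block lengths. Everything in which a short cube or a second
  occurrence of the marker could arise is visible in a bounded window, of which there are finitely many.
  A cube of period \<open>p \<ge> length m\<close> between two markers has at most \<open>length m - 1\<close> letters outside the
  Thue-Morse part on each side. If it stays inside that part on one side, more than \<open>2 * p\<close> of its letters lie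
  there and form an overlap. Otherwise the whole part is covered, and the lower bound on \<open>N\<close> again
  gives an overlap.\<close>
lemma cubefree_block_thue_morse_marker:
  fixes a N :: nat and m :: "bool list"
  defines "t \<equiv> map thue_morse [a..<N]"
  assumes ok: "junction_ok a m" and N: "4 dvd N" "N \<ge> 36" and a: "a \<le> 3"
    and m: "m \<noteq> []" "length m \<le> 12" "N > a + 4 * (length m - 1)"
  shows "cubefree_block (t @ m)"
proof (rule cubefree_block_marker[OF m(1)])
  let ?u = "t @ m" and ?c = "length m" and ?k = "length (t @ m)"
  define n where "n = N - a"
  define W where "W = 3 * (?c - 1)"
  have c: "?c \<ge> 1" using m(1) by (cases m) auto
  have t: "length t = n" "\<And>i. i < n \<Longrightarrow> t ! i = thue_morse (a + i)"
    by (auto simp: t_def n_def)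
  have k: "?k = n + ?c" "?k > 0" using t c by auto
  have W: "W \<le> 33" "W \<le> n" "a + n = N" "4 * (?c - 1) < n" using m c by (auto simp: W_def n_def)
  have occ: "take 32 (occurrences m (block_map thue_morse_block [b1, b2])) = replicate 32 False" for b1 b2
    using ok by (cases b1; cases b2) (simp_all add: junction_ok_def)
  have no_marker: "\<not> occurrences m (block_map thue_morse_block [b1, b2]) ! r" if "r < 32" for b1 b2 r
    using arg_cong[OF occ[of b1 b2], of "\<lambda>l. l ! r"] that by simp
  define q r where "q = (N - 36) div 32" and "r = (N - 36) mod 32"
  have r: "N - 36 = 32 * q + r" "r < 32" by (simp_all add: q_def r_def)
  have "4 dvd N - 36" using N by simp
  then have "4 dvd r" unfolding r_def by (simp add: dvd_mod)
  then have r': "r \<in> set [0, 4, 8, 12, 16, 20, 24, 28]" using r(2) by (auto elim!: dvdE)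
  then have r28: "r \<le> 28" by auto
  define V where "V = junction a m r (thue_morse q) (thue_morse (q + 1))"
  have "window_ok m W (Suc (2 * W)) (junction a m r b1 b2 b)" for b1 b2 b
    using ok r' by (cases b1; cases b2; cases b) (auto simp: junction_ok_def W_def)
  then have window: "window_ok m W (Suc (2 * W)) (V b)" for b by (simp add: V_def)
  have thue_morse_block_len: "length thue_morse_block = 32" by (simp add: thue_morse_block_eq)
  have V_eq: "V b = map thue_morse [N-W..<N] @ m @ map (\<lambda>y. thue_morse (a + y) \<noteq> b) [0..<W]" for b
  proof -
    have "take W (drop (r + 36 - W) (block_map thue_morse_block [thue_morse q, thue_morse (q + 1)])) = map thue_morse [N-W..<N]"
    proof (rule nth_equalityI)
      fix i assume "i < length (take W (drop (r + 36 - W) (block_map thue_morse_block [thue_morse q, thue_morse (q + 1)])))"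
      then have i: "i < W" by simp
      define x where "x = r + 36 - W"
      have x: "x + W = r + 36" using W by (simp add: x_def)
      have "N - W + i = 32 * q + (x + i)" "x + i < 64" using x r(1) r28 N W i by linarith+
      then have "thue_morse (N - W + i) = block_map thue_morse_block [thue_morse q, thue_morse (q + 1)] ! (x + i)"
        using thue_morse_window[of "x + i" q] by (simp only:)
      then show "take W (drop (r + 36 - W) (block_map thue_morse_block [thue_morse q, thue_morse (q + 1)])) ! i = map thue_morse [N-W..<N] ! i"
        unfolding x_def[symmetric] using i r28 x W N by (simp add: thue_morse_block_len)
    qed (use r28 W N in \<open>simp add: thue_morse_block_len\<close>)
    moreover have "take W (drop a (block_map thue_morse_block [b, \<not> b])) = map (\<lambda>y. thue_morse (a + y) \<noteq> b) [0..<W]"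
    proof (rule nth_equalityI)
      fix i assume "i < length (take W (drop a (block_map thue_morse_block [b, \<not> b])))"
      then have i: "i < W" "a + i < 64" using a W by auto
      have "thue_morse (a + i) \<longleftrightarrow> block_map thue_morse_block [False, True] ! (a + i)"
        using thue_morse_window[of "a + i" 0] i by (simp add: thue_morse.simps[of 0] thue_morse_double(2)[of 0, simplified])
      also have "block_map thue_morse_block [False, True] ! (a + i) \<longleftrightarrow> block_map thue_morse_block [b, \<not> b] ! (a + i) \<noteq> b"
      proof -
        have "(a + i) div 32 = 0 \<or> (a + i) div 32 = 1" using i by linarith
        then show ?thesis using i by (auto simp: nth_block_map block_seq_def thue_morse_block_len)
      qed
      finally show "take W (drop a (block_map thue_morse_block [b, \<not> b])) ! i = map (\<lambda>y. thue_morse (a + y) \<noteq> b) [0..<W] ! i"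
        using i a by (auto simp: thue_morse_block_len)
    qed (use a W in \<open>simp add: thue_morse_block_len\<close>)
    ultimately show ?thesis by (simp add: V_def junction_def Let_def W_def)
  qed
  have V_len: "length (V b) = 2 * W + ?c" for b using W by (simp add: V_eq)
  have V: "block_seq ?u w (?k * j + (n - W) + y) \<longleftrightarrow> V (w j \<noteq> w (j + 1)) ! y \<noteq> w j"
    if y: "y < 2 * W + ?c" for w j y
  proof -
    consider "y < W" | "W \<le> y" "y < W + ?c" | z where "y = W + ?c + z" "z < W"
    proof -
      have "y = W + ?c + (y - (W + ?c)) \<and> y - (W + ?c) < W" if "W + ?c \<le> y" using that y by linarith
      then show thesis using that by (metis not_less)
    qed
    then show ?thesis
    proof cases
      case 1
      have "n - W + y < n" "a + (n - W + y) = N - W + y" using 1 W(2,3) by auto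
      then have "?u ! (n - W + y) = thue_morse (N - W + y)" using t by (simp only: nth_append if_True)
      then show ?thesis using 1 W(2,3) k block_seq_at[of "n - W + y" ?u w j]
        by (simp add: V_eq nth_append add.assoc)
    next
      case 2
      have "\<not> n - W + y < n" "n - W + y - n = y - W" and x: "y - W < ?c" using 2 W(2) by auto
      from this(1,2) have "?u ! (n - W + y) = m ! (y - W)" using t(1) by (simp only: nth_append if_False)
      then show ?thesis using 2 x W(2,3) k block_seq_at[of "n - W + y" ?u w j]
        by (simp add: V_eq nth_append add.assoc)
    next
      case 3
      have eq: "?k * j + (n - W) + y = ?k * (j + 1) + z" using 3 W(2) k by simp
      have "?u ! z = thue_morse (a + z)" using 3 W(2) t by (simp add: nth_append)
      moreover have "V (w j \<noteq> w (j + 1)) ! y \<longleftrightarrow> thue_morse (a + z) \<noteq> (w j \<noteq> w (j + 1))"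
        using 3 W(2,3) by (simp add: V_eq nth_append)
      ultimately show ?thesis unfolding eq using 3 W(2) k block_seq_at[of z ?u w "j + 1"] by auto
    qed
  qed
  fix w s
  define h j where "h = s mod ?k" and "j = s div ?k"
  have h: "s = ?k * j + h" "h < n + ?c" using k by (auto simp: h_def j_def)
  show "s mod ?k = length t" if d: "\<forall>i<?c. block_seq ?u w (s + i) \<longleftrightarrow> m ! i \<noteq> d" for d
  proof (cases "h + ?c \<le> n")
    case True
    define Q R where "Q = (a + h) div 32" and "R = (a + h) mod 32"
    have QR: "a + h = 32 * Q + R" "R < 32" by (simp_all add: Q_def R_def)
    have "occurrences m (block_map thue_morse_block [thue_morse Q, thue_morse (Q + 1)]) ! R"
    proof (rule occurrencesI[where d = "d \<noteq> w j"])
      fix i assume i: "i < ?c"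
      have "s + i = ?k * j + (h + i)" by (simp add: h(1))
      then have "block_seq ?u w (s + i) \<longleftrightarrow> thue_morse (a + (h + i)) \<noteq> w j"
        using i True t k block_seq_at[of "h + i" ?u w j] by (simp add: nth_append add.assoc)
      moreover have "thue_morse (a + (h + i)) = block_map thue_morse_block [thue_morse Q, thue_morse (Q + 1)] ! (R + i)"
        using thue_morse_window[of "R + i" Q] QR i m(2) by (simp add: add.assoc[symmetric])
      ultimately show "block_map thue_morse_block [thue_morse Q, thue_morse (Q + 1)] ! (R + i) \<longleftrightarrow> m ! i \<noteq> (d \<noteq> w j)"
        using d i by blast
    qed (use QR m(2) in \<open>simp_all add: thue_morse_block_len\<close>)
    then show ?thesis using no_marker QR(2) by blast
  next
    case False
    define y where "y = h - (n - W)"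
    have hy: "h = n - W + y" "y \<le> 2 * W" using False W h(2) c by (auto simp: y_def W_def)
    have "occurrences m (V (w j \<noteq> w (j + 1))) ! y"
    proof (rule occurrencesI[where d = "d \<noteq> w j"])
      fix i assume i: "i < ?c"
      have "s + i = ?k * j + (n - W) + (y + i)" unfolding h(1) hy(1) by simp
      then have "block_seq ?u w (s + i) \<longleftrightarrow> V (w j \<noteq> w (j + 1)) ! (y + i) \<noteq> w j"
        using V[of "y + i" w j] hy(2) i by (simp only:)
      then show "V (w j \<noteq> w (j + 1)) ! (y + i) \<longleftrightarrow> m ! i \<noteq> (d \<noteq> w j)"
        using d i by blast
    qed (use hy(2) V_len c in simp_all)
    then have "y = W" using window_okD(1)[OF window] hy(2) by (simp add: less_Suc_eq_le)
    then show ?thesis using hy(1) W t(1) by (simp add: h_def)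
  qed
  fix p
  have no_overlap: "\<not> run (block_seq ?u w) p s' l"
    if "1 \<le> p" "2 * p < l" "?k * j' \<le> s'" "s' + l \<le> ?k * j' + n" for s' l j'
  proof
    assume "run (block_seq ?u w) p s' l"
    then have "run thue_morse p (a + (s' - ?k * j')) l" using run_within_thue_morse_part[OF t] that by blast
    then have "run thue_morse p (a + (s' - ?k * j')) (2 * p + 1)" by (rule run_subset) (use that in auto)
    then show False using thue_morse_overlap_free that(1) by blast
  qed
  show "\<not> run (block_seq ?u w) p s (3 * p)" if p: "1 \<le> p" "p < ?c"
  proof (cases "h + 3 * p \<le> n")
    case True
    then show ?thesis using no_overlap[of "3 * p" j s] p h(1) by simp
  next
    case False
    define y where "y = h - (n - W)"
    have hy: "h = n - W + y" "y + 3 * p \<le> 2 * W + ?c" using False W h(2) p by (auto simp: y_def W_def)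
    show ?thesis
    proof (rule no_cube_imp_not_run[OF window_okD(2)[OF window p]])
      show "y + 3 * p \<le> length (V (w j \<noteq> w (j + 1)))" using hy(2) V_len by simp
      fix i assume i: "i < 3 * p"
      have "s + i = ?k * j + (n - W) + (y + i)" unfolding h(1) hy(1) by simp
      then show "block_seq ?u w (s + i) \<longleftrightarrow> V (w j \<noteq> w (j + 1)) ! (y + i) \<noteq> w j"
        using V[of "y + i" w j] hy(2) i by (simp only:)
    qed
  qed
  show "\<not> run (block_seq ?u w) p s (3 * p)" if p: "?c \<le> p" "length t < s" "s + 3 * p < 2 * ?k"
  proof
    assume run: "run (block_seq ?u w) p s (3 * p)"
    define s' e' where "s' = max s ?k" and "e' = min (s + 3 * p) (?k + n)"
    have "2 * p < e' - s'" "s \<le> s'" "e' \<le> s + 3 * p" "?k \<le> s'" "e' \<le> ?k + n" "s' \<le> e'"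
      using p k t(1) c W(4) by (auto simp: s'_def e'_def max_def min_def)
    then show False using no_overlap[of "e' - s'" 1 s'] p(1) c run_subset[OF run, of s' "e' - s'"] by auto
  qed
qed

section \<open>Blocks of all admissible lengths\<close>

text \<open>The marker for block lengths congruent to 1 modulo 4; it is preceded by the Thue-Morse letters
  from position 3 on.\<close>
definition marker_1 where "marker_1 = bits ''010011001001''"

text \<open>The marker for block lengths congruent to 3 modulo 4; it is preceded by a prefix of the
  Thue-Morse sequence.\<close>
definition marker_3 where "marker_3 = bits ''01001101001''"

text \<open>Words found by exhaustive search, for the odd lengths that the Thue-Morse words do not cover and
  for length 12, which cannot be obtained by doubling.\<close>
lemma small_words:
  "marker_ok (bits ''0'') (bits ''1101'')"
  "marker_ok (bits ''011'') (bits ''0010'')"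
  "marker_ok (bits ''01100'') (bits ''1101'')"
  "marker_ok (bits ''01100'') (bits ''101101'')"
  "marker_ok (bits ''011001'') (bits ''010010'')"
  "marker_ok (bits ''0110011'') (bits ''010010'')"
  "marker_ok (bits ''01100100110'') (bits ''101101'')"
  by code_simp+

text \<open>In this range the Thue-Morse part is shorter than the general argument requires, so the members
  of the two families are checked directly.\<close>
lemma medium_3:
  "marker_ok (map thue_morse [0..<4]) marker_3"
  "marker_ok (map thue_morse [0..<8]) marker_3"
  "marker_ok (map thue_morse [0..<12]) marker_3"
  "marker_ok (map thue_morse [0..<16]) marker_3"
  "marker_ok (map thue_morse [0..<20]) marker_3"
  "marker_ok (map thue_morse [0..<24]) marker_3"
  "marker_ok (map thue_morse [0..<28]) marker_3"
  "marker_ok (map thue_morse [0..<32]) marker_3"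
  "marker_ok (map thue_morse [0..<36]) marker_3"
  "marker_ok (map thue_morse [0..<40]) marker_3"
  by code_simp+

lemma medium_1:
  "marker_ok (map thue_morse [3..<12]) marker_1"
  "marker_ok (map thue_morse [3..<16]) marker_1"
  "marker_ok (map thue_morse [3..<20]) marker_1"
  "marker_ok (map thue_morse [3..<24]) marker_1"
  "marker_ok (map thue_morse [3..<28]) marker_1"
  "marker_ok (map thue_morse [3..<32]) marker_1"
  "marker_ok (map thue_morse [3..<36]) marker_1"
  "marker_ok (map thue_morse [3..<40]) marker_1"
  "marker_ok (map thue_morse [3..<44]) marker_1"
  by code_simp+

lemma junction_ok_3: "junction_ok 0 marker_3"
  by code_simp

lemma junction_ok_1: "junction_ok 3 marker_1"
  by code_simp

lemma cubefree_block_odd: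
  assumes "odd k" "k \<noteq> 3"
  shows "\<exists>u. length u = k \<and> cubefree_block u"
proof -
  have ok: ?thesis if "marker_ok t m" "length t + length m = k" for t m
    using cubefree_block_if_marker_ok[OF that(1)] that(2) by (intro exI[of _ "t @ m"]) simp
  have lengths: "length marker_1 = 12" "length marker_3 = 11" by (simp_all add: marker_1_def marker_3_def bits_def)
  have "k mod 4 = 1 \<or> k mod 4 = 3" using assms(1) by presburger
  moreover define q where "q = k div 4"
  ultimately have q: "k = 4 * q + 1 \<or> k = 4 * q + 3"
    by (metis mult_div_mod_eq)
  consider "k = 1" | "k \<in> {5, 7, 9, 11, 13, 17}" | "k \<in> {21, 25, 29, 33, 37, 41, 45, 49, 53}"
    | "k \<in> {15, 19, 23, 27, 31, 35, 39, 43, 47, 51}"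
    | "k = 4 * q + 1" "k \<ge> 57" | "k = 4 * q + 3" "k \<ge> 55"
  proof -
    have "[0..<14] = [0, 1, 2, 3, 4, 5, 6, 7, 8, 9, 10, 11, 12, 13]" by code_simp
    moreover have "q \<in> set [0..<14] \<or> q \<ge> 14" by auto
    ultimately have "q \<in> {0, 1, 2, 3, 4, 5, 6, 7, 8, 9, 10, 11, 12, 13} \<or> q \<ge> 14"
      by (simp only: list.set)
    then have "k \<in> {1, 5, 7, 9, 11, 13, 17} \<or> k \<in> {21, 25, 29, 33, 37, 41, 45, 49, 53}
        \<or> k \<in> {15, 19, 23, 27, 31, 35, 39, 43, 47, 51} \<or> k = 4 * q + 1 \<and> k \<ge> 57 \<or> k = 4 * q + 3 \<and> k \<ge> 55"
      using q assms(2) by (elim disjE insertE) auto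
    then show thesis using that by blast
  qed
  then show ?thesis
  proof cases
    case 1
    have "block_seq [False] w = w" for w by (simp add: block_seq_def fun_eq_iff)
    then have "cubefree_block [False]"
      unfolding cubefree_block_def by (auto intro!: exI[of _ 2])
    then show ?thesis using 1 by (intro exI[of _ "[False]"]) simp
  next
    case 2
    then show ?thesis using small_words[THEN ok] by (auto simp: bits_def)
  next
    case 3
    then show ?thesis using medium_1[THEN ok] by (auto simp: lengths)
  next
    case 4
    then show ?thesis using medium_3[THEN ok] by (auto simp: lengths)
  next
    case 5
    have "k - 9 = 4 * (q - 2)" using 5 by simp
    then have "cubefree_block (map thue_morse [3..<k-9] @ marker_1)"
      using 5 by (intro cubefree_block_thue_morse_marker junction_ok_1) (auto simp: lengths simp flip: length_greater_0_conv)
    then show ?thesis using 5 by (intro exI[of _ "map thue_morse [3..<k-9] @ marker_1"]) (simp add: lengths)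
  next
    case 6
    have "k - 11 = 4 * (q - 2)" using 6 by simp
    then have "cubefree_block (map thue_morse [0..<k-11] @ marker_3)"
      using 6 by (intro cubefree_block_thue_morse_marker junction_ok_3) (auto simp: lengths simp flip: length_greater_0_conv)
    then show ?thesis using 6 by (intro exI[of _ "map thue_morse [0..<k-11] @ marker_3"]) (simp add: lengths)
  qed
qed

text \<open>Odd lengths suffice, since composition with the Thue-Morse morphism doubles the length. Among the
  even lengths other than 6, only 12 is not twice an admissible length.\<close>
lemma cubefree_block_exists:
  assumes "k \<ge> 1" "k \<noteq> 3" "k \<noteq> 6"
  shows "\<exists>u. length u = k \<and> cubefree_block u"
  using assms
proof (induction k rule: less_induct)
  case (less k)
  show ?case
  proof (cases "odd k")
    case True
    then show ?thesis using cubefree_block_odd less.prems by blast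
  next
    case False
    then obtain q where q: "k = 2 * q" by blast
    show ?thesis
    proof (cases "q = 6")
      case True
      have "length (bits ''011001'' @ bits ''010010'') = k" using q True by (simp add: bits_def)
      then show ?thesis using cubefree_block_if_marker_ok[OF small_words(5)] by blast
    next
      case False
      then have "\<exists>v. length v = q \<and> cubefree_block v" using less.IH[of q] less.prems q by auto
      then obtain v where "length v = q" "cubefree_block v" by blast
      then show ?thesis using q cubefree_block_block_map[OF cubefree_block_thue_morse, of v]
        by (intro exI[of _ "block_map [False, True] v"]) simp
    qed
  qed
qed

section \<open>Lengths 3 and 6\<close>

lemma cubefree_001: "cubefree (Fin [False, False, True])"
  unfolding cubefree_Fin_iff
proof (intro exI[of _ 2] conjI)
  show "runs_bounded 2 (nth [False, False, True]) (length [False, False, True])"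
    unfolding runs_bounded_def
  proof (intro allI impI)
    fix p s n :: nat
    assume *: "1 \<le> p" "p \<le> n" "s + n \<le> length [False, False, True]" "run (nth [False, False, True]) p s n"
    have "\<not> (p = 1 \<and> n = 3)"
    proof
      assume "p = 1 \<and> n = 3"
      then show False using * by (auto simp: run_def dest!: spec[of _ 1])
    qed
    then show "real n \<le> 2 * real p" using * by (cases "p = 1") auto
  qed
qed simp

text \<open>Only the periods 1, 2 and 4 are tried; they suffice for the images below.\<close>
definition has_cube :: "bool list \<Rightarrow> bool" where
  "has_cube w \<longleftrightarrow> (\<exists>p\<in>set [1, 2, 4]. \<exists>s\<in>set [0..<Suc (length w - 3 * p)].
     s + 3 * p \<le> length w \<and> take (2 * p) (drop s w) = take (2 * p) (drop (s + p) w))"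

lemma has_cube_not_cubefree:
  assumes "has_cube w"
  shows "\<not> cubefree (Fin w)"
proof -
  obtain p s where "p \<in> set [1, 2, 4]"
    and p: "s + 3 * p \<le> length w" "take (2 * p) (drop s w) = take (2 * p) (drop (s + p) w)"
    using assms unfolding has_cube_def by blast
  then have "1 \<le> p" by auto
  have "run (nth w) p s (3 * p)"
    unfolding run_def
  proof (intro allI impI)
    fix i assume i: "s \<le> i" "i + p < s + 3 * p"
    then show "w ! i = w ! (i + p)"
      using arg_cong[OF p(2), of "\<lambda>v. v ! (i - s)"] p(1) by (simp add: add_ac)
  qed
  then show ?thesis using cubefree_no_cube p(1) \<open>1 \<le> p\<close> by blast
qed

text \<open>For lengths 3 and 6 the cubefree word 001 already refutes every candidate.\<close>
lemma image_001_has_cube: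
  "\<forall>u\<in>set (List.n_lists 3 [False, True]) \<union> set (List.n_lists 6 [False, True]).
     has_cube (block_map u [False, False, True])"
  by code_simp

section \<open>The characterisation\<close>

theorem theorem8:
  fixes k :: nat
  assumes "k \<ge> 1"
  shows "(\<exists>h :: bool list \<Rightarrow> bool list. uniform k h \<and> complementary h \<and> cubefree_morphism h)
    \<longleftrightarrow> k \<noteq> 3 \<and> k \<noteq> 6"
proof
  assume "\<exists>h :: bool list \<Rightarrow> bool list. uniform k h \<and> complementary h \<and> cubefree_morphism h"
  then obtain h :: "bool list \<Rightarrow> bool list" where h: "uniform k h" "complementary h" "cubefree_morphism h" by blast
  define u where "u = h [False]"
  have "cubefree (image_word h (Fin [False, False, True]))"
    using h(3) cubefree_001 unfolding cubefree_morphism_def by blast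
  then have "cubefree (Fin (block_map u [False, False, True]))"
    using morphism_eq_block_map[OF h(1,2), of "[False, False, True]"] by (simp add: u_def)
  moreover have "length u = k" using h(1) by (simp add: u_def uniform_def)
  ultimately show "k \<noteq> 3 \<and> k \<noteq> 6"
    using image_001_has_cube has_cube_not_cubefree by (auto simp: set_n_lists UNIV_bool)
next
  assume "k \<noteq> 3 \<and> k \<noteq> 6"
  then obtain u where "length u = k" "cubefree_block u" using cubefree_block_exists assms by blast
  then show "\<exists>h :: bool list \<Rightarrow> bool list. uniform k h \<and> complementary h \<and> cubefree_morphism h"
    using cubefree_block_imp_morphism by blast
qed

end
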